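(* The ring ${}^\bullet\mathbb{R}$ is complete with respect to the metric $d_\omega(x,y):=|{}^\circ x-{}^\circ y|+\omega(x-y)$.
   Context: Fermat reals. A little-oh polynomial is a function $x:\mathbb{R}_{\ge0}\to\mathbb{R}$ such that $x(t)=r+\sum_{i=1}^N a_i t^{\alpha_i}+o(t)$ as $t\to0^+$, for some $N\in\mathbb{N}$, $r,a_i\in\mathbb{R}$, $\alpha_i\in\mathbb{R}_{\ge0}$. Put $x\sim y$ iff $x(t)=y(t)+o(t)$ as $t\to0^+$. The ring ${}^\bullet\mathbb{R}$ of Fermat reals is the quotient of the ring of little-oh polynomials (pointwise operations) by $\sim$; it contains $\mathbb{R}$ (classes of constants). For real $a>0$, $\mathrm{d}t_a$ denotes the class of $t\mapsto t^{1/a}$ (so $\mathrm{d}t_a=0$ iff $a<1$). Every $x\in{}^\bullet\mathbb{R}$ can be written uniquely as $x={}^\circ x+\sum_{i=1}^N\alpha_i\,\mathrm{d}t_{a_i}$ with ${}^\circ x,\alpha_i\in\mathbb{R}$, $\alpha_i\ne0$, $a_1>\dots>a_N\ge1$, $N\ge0$ (the decomposition of $x$). ${}^\circ x$ is the standard part of $x$, and the order is $\omega(x):=a_1$ if $N\ge1$, $\omega(x):=0$ if $x\in\mathbb{R}$. *)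

theory Defs
  imports "HOL-Analysis.Analysis" "HOL-Library.Landau_Symbols"
begin

text \<open>
  Little-oh polynomials are functions on the half-line \<open>t \<ge> 0\<close>. They are represented by total
  functions on the reals; both definitions below only look at the germ along \<open>at_right 0\<close>,
  so the values at \<open>t < 0\<close> are irrelevant and disappear in the quotient.
\<close>

definition little_oh_poly :: "(real \<Rightarrow> real) \<Rightarrow> bool" where
  "little_oh_poly x \<longleftrightarrow>
     (\<exists>(r::real) (N::nat) (a::nat \<Rightarrow> real) (\<alpha>::nat \<Rightarrow> real).
        (\<forall>i\<in>{1..N}. \<alpha> i \<ge> 0) \<and>
        (\<lambda>t. x t - (r + (\<Sum>i=1..N. a i * t powr \<alpha> i))) \<in> o[at_right 0](\<lambda>t. t))"

definition fermat_rel :: "(real \<Rightarrow> real) \<Rightarrow> (real \<Rightarrow> real) \<Rightarrow> bool" where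
  "fermat_rel x y \<longleftrightarrow>
     little_oh_poly x \<and> little_oh_poly y \<and> (\<lambda>t. x t - y t) \<in> o[at_right 0](\<lambda>t. t)"

lemma little_oh_poly_cong:
  assumes "little_oh_poly x" "(\<lambda>t. y t - x t) \<in> o[at_right 0](\<lambda>t. t)"
  shows "little_oh_poly y"
proof -
  obtain r N a \<alpha> where *: "\<forall>i\<in>{1..N::nat}. \<alpha> i \<ge> (0::real)"
    "(\<lambda>t. x t - (r + (\<Sum>i=1..N. a i * t powr \<alpha> i))) \<in> o[at_right 0](\<lambda>t. t)"
    using assms(1) unfolding little_oh_poly_def by blast
  have "(\<lambda>t. y t - (r + (\<Sum>i=1..N. a i * t powr \<alpha> i))) \<in> o[at_right 0](\<lambda>t. t)"
    using sum_in_smallo(1)[OF assms(2) *(2)] by (simp add: algebra_simps)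
  with *(1) show ?thesis unfolding little_oh_poly_def by blast
qed

lemma little_oh_poly_const: "little_oh_poly (\<lambda>_. c)"
  unfolding little_oh_poly_def by (intro exI[of _ c] exI[of _ "0::nat"]) simp

lemma little_oh_poly_monom:
  assumes "e \<ge> 0"
  shows "little_oh_poly (\<lambda>t. c * t powr e)"
  unfolding little_oh_poly_def
  by (intro exI[of _ 0] exI[of _ "1::nat"] exI[of _ "\<lambda>_. c"] exI[of _ "\<lambda>_. e"])
     (use assms in simp)

lemma little_oh_poly_powr:
  assumes "e \<ge> 0"
  shows "little_oh_poly (\<lambda>t. t powr e)"
  using little_oh_poly_monom[OF assms, of 1] by simp

lemma little_oh_poly_add:
  assumes "little_oh_poly x" "little_oh_poly y"
  shows "little_oh_poly (\<lambda>t. x t + y t)"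
proof -
  obtain r N a \<alpha> where 1: "\<forall>i\<in>{1..N::nat}. \<alpha> i \<ge> (0::real)"
    "(\<lambda>t. x t - (r + (\<Sum>i=1..N. a i * t powr \<alpha> i))) \<in> o[at_right 0](\<lambda>t. t)"
    using assms(1) unfolding little_oh_poly_def by blast
  obtain s M b \<beta> where 2: "\<forall>i\<in>{1..M::nat}. \<beta> i \<ge> (0::real)"
    "(\<lambda>t. y t - (s + (\<Sum>i=1..M. b i * t powr \<beta> i))) \<in> o[at_right 0](\<lambda>t. t)"
    using assms(2) unfolding little_oh_poly_def by blast
  define c where "c i = (if i \<le> N then a i else b (i - N))" for i
  define \<gamma> where "\<gamma> i = (if i \<le> N then \<alpha> i else \<beta> (i - N))" for i
  have pos: "\<forall>i\<in>{1..N+M}. \<gamma> i \<ge> 0"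
  proof
    fix i assume "i \<in> {1..N+M}"
    then have "i \<in> {1..N} \<or> \<not> i \<le> N \<and> i - N \<in> {1..M}" by auto
    then show "\<gamma> i \<ge> 0" using 1(1) 2(1) by (auto simp: \<gamma>_def)
  qed
  have eq: "(\<Sum>i=1..N+M. c i * t powr \<gamma> i) =
      (\<Sum>i=1..N. a i * t powr \<alpha> i) + (\<Sum>i=1..M. b i * t powr \<beta> i)" for t
  proof -
    have split: "{1..N+M} = {1..N} \<union> {N+1..N+M}" by auto
    have "(\<Sum>i=1..N+M. c i * t powr \<gamma> i) =
        (\<Sum>i=1..N. c i * t powr \<gamma> i) + (\<Sum>i=N+1..N+M. c i * t powr \<gamma> i)"
      unfolding split by (rule sum.union_disjoint) auto
    also have "(\<Sum>i=1..N. c i * t powr \<gamma> i) = (\<Sum>i=1..N. a i * t powr \<alpha> i)"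
      by (rule sum.cong) (auto simp: c_def \<gamma>_def)
    also have "(\<Sum>i=N+1..N+M. c i * t powr \<gamma> i) = (\<Sum>i=1..M. b i * t powr \<beta> i)"
      by (rule sum.reindex_bij_witness[of _ "\<lambda>i. i + N" "\<lambda>i. i - N"])
         (auto simp: c_def \<gamma>_def)
    finally show ?thesis .
  qed
  have "(\<lambda>t. x t + y t - (r + s + (\<Sum>i=1..N+M. c i * t powr \<gamma> i))) \<in> o[at_right 0](\<lambda>t. t)"
    using sum_in_smallo(1)[OF 1(2) 2(2)] unfolding eq by (simp add: algebra_simps)
  with pos show ?thesis unfolding little_oh_poly_def by blast
qed

lemma little_oh_poly_sum:
  assumes "finite A" "\<And>i. i \<in> A \<Longrightarrow> little_oh_poly (f i)"
  shows "little_oh_poly (\<lambda>t. \<Sum>i\<in>A. f i t)"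
  using assms
  by (induction A rule: finite_induct) (auto intro: little_oh_poly_const little_oh_poly_add)

lemma powr_bounded_at_right_0:
  assumes "e \<ge> (0::real)"
  shows "(\<lambda>t. t powr e) \<in> O[at_right 0](\<lambda>_. 1::real)"
proof (rule bigoI[of _ 1])
  have "eventually (\<lambda>t. t \<in> {0<..<1}) (at_right (0::real))"
    by (rule eventually_at_right_real) simp
  then show "eventually (\<lambda>t. norm (t powr e) \<le> 1 * norm (1::real)) (at_right 0)"
    by eventually_elim (use assms in \<open>auto intro: powr_le1\<close>)
qed

lemma little_oh_poly_mult_aux:
  assumes "little_oh_poly x" "little_oh_poly y"
  obtains p q where "little_oh_poly (\<lambda>t. p t * q t)"
    "p \<in> O[at_right 0](\<lambda>_. 1)" "q \<in> O[at_right 0](\<lambda>_. 1)"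
    "(\<lambda>t. x t - p t) \<in> o[at_right 0](\<lambda>t. t)" "(\<lambda>t. y t - q t) \<in> o[at_right 0](\<lambda>t. t)"
proof -
  obtain r N a \<alpha> where 1: "\<forall>i\<in>{1..N::nat}. \<alpha> i \<ge> (0::real)"
    "(\<lambda>t. x t - (r + (\<Sum>i=1..N. a i * t powr \<alpha> i))) \<in> o[at_right 0](\<lambda>t. t)"
    using assms(1) unfolding little_oh_poly_def by blast
  obtain s M b \<beta> where 2: "\<forall>i\<in>{1..M::nat}. \<beta> i \<ge> (0::real)"
    "(\<lambda>t. y t - (s + (\<Sum>i=1..M. b i * t powr \<beta> i))) \<in> o[at_right 0](\<lambda>t. t)"
    using assms(2) unfolding little_oh_poly_def by blast
  let ?p = "\<lambda>t. r + (\<Sum>i=1..N. a i * t powr \<alpha> i)"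
  let ?q = "\<lambda>t. s + (\<Sum>i=1..M. b i * t powr \<beta> i)"
  have bdd: "(\<lambda>t. u + (\<Sum>i=1..K. d i * t powr \<delta> i)) \<in> O[at_right 0](\<lambda>_. 1::real)"
    if "\<forall>i\<in>{1..K::nat}. \<delta> i \<ge> (0::real)" for u K d \<delta>
    using that by (intro sum_in_bigo big_sum_in_bigo) (auto intro: powr_bounded_at_right_0)
  have "?p t * ?q t = r * s + (\<Sum>j=1..M. r * b j * t powr \<beta> j) + (\<Sum>i=1..N. s * a i * t powr \<alpha> i)
      + (\<Sum>i=1..N. \<Sum>j=1..M. (a i * b j) * t powr (\<alpha> i + \<beta> j))" for t
  proof -
    have "?p t * ?q t = r * s + r * (\<Sum>j=1..M. b j * t powr \<beta> j)
        + s * (\<Sum>i=1..N. a i * t powr \<alpha> i)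
        + (\<Sum>i=1..N. a i * t powr \<alpha> i) * (\<Sum>j=1..M. b j * t powr \<beta> j)"
      by (simp only: distrib_left distrib_right ac_simps)
    then show ?thesis
      unfolding sum_product powr_add unfolding sum_distrib_left by (simp only: mult_ac)
  qed
  moreover have "little_oh_poly (\<lambda>t. r * s + (\<Sum>j=1..M. r * b j * t powr \<beta> j)
      + (\<Sum>i=1..N. s * a i * t powr \<alpha> i)
      + (\<Sum>i=1..N. \<Sum>j=1..M. (a i * b j) * t powr (\<alpha> i + \<beta> j)))"
    using 1(1) 2(1)
    by (intro little_oh_poly_add little_oh_poly_sum little_oh_poly_const little_oh_poly_monom) auto
  ultimately have "little_oh_poly (\<lambda>t. ?p t * ?q t)" by simp
  from that[OF this bdd[OF 1(1)] bdd[OF 2(1)] 1(2) 2(2)] show ?thesis .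
qed

lemma id_smallo_1_at_right_0: "(\<lambda>t. t) \<in> o[at_right 0](\<lambda>_. 1::real)"
  by (rule smalloI_tendsto) (auto intro: tendsto_eq_intros)

lemma little_oh_poly_bounded:
  assumes "little_oh_poly x"
  shows "x \<in> O[at_right 0](\<lambda>_. 1)"
proof -
  obtain p q where pq: "p \<in> O[at_right 0](\<lambda>_. 1)" "(\<lambda>t. x t - p t) \<in> o[at_right 0](\<lambda>t. t)"
    by (rule little_oh_poly_mult_aux[OF assms assms])
  have "(\<lambda>t. x t - p t) \<in> O[at_right 0](\<lambda>_. 1)"
    using landau_o.small_trans[OF pq(2) id_smallo_1_at_right_0] by (rule landau_o.small_imp_big)
  from sum_in_bigo(1)[OF this pq(1)] show ?thesis by simp
qed

lemma smallo_mult_diff: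
  assumes "x \<in> O[at_right 0](\<lambda>_. 1::real)" "y' \<in> O[at_right 0](\<lambda>_. 1)"
    "(\<lambda>t. x t - x' t) \<in> o[at_right 0](\<lambda>t. t)" "(\<lambda>t. y t - y' t) \<in> o[at_right 0](\<lambda>t. t)"
  shows "(\<lambda>t. x t * y t - x' t * y' t) \<in> o[at_right 0](\<lambda>t. t)"
proof -
  have "(\<lambda>t. (x t - x' t) * y' t) \<in> o[at_right 0](\<lambda>t. t)"
    by (rule landau_o.small_1_mult[OF assms(3,2)])
  moreover have "(\<lambda>t. x t * (y t - y' t)) \<in> o[at_right 0](\<lambda>t. t)"
    using landau_o.small_1_mult[OF assms(4,1)] by (simp only: mult.commute)
  ultimately have "(\<lambda>t. (x t - x' t) * y' t + x t * (y t - y' t)) \<in> o[at_right 0](\<lambda>t. t)"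
    by (rule sum_in_smallo)
  then show ?thesis by (simp add: algebra_simps)
qed

lemma little_oh_poly_mult:
  assumes "little_oh_poly x" "little_oh_poly y"
  shows "little_oh_poly (\<lambda>t. x t * y t)"
proof -
  obtain p q where pq: "little_oh_poly (\<lambda>t. p t * q t)" "q \<in> O[at_right 0](\<lambda>_. 1)"
    "(\<lambda>t. x t - p t) \<in> o[at_right 0](\<lambda>t. t)" "(\<lambda>t. y t - q t) \<in> o[at_right 0](\<lambda>t. t)"
    by (rule little_oh_poly_mult_aux[OF assms])
  from little_oh_poly_cong[OF pq(1) smallo_mult_diff[OF little_oh_poly_bounded[OF assms(1)] pq(2-4)]]
  show ?thesis .
qed

lemma little_oh_poly_uminus:
  assumes "little_oh_poly x"
  shows "little_oh_poly (\<lambda>t. - x t)"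
  using little_oh_poly_mult[OF little_oh_poly_const[of "-1"] assms] by simp

lemma little_oh_poly_diff:
  assumes "little_oh_poly x" "little_oh_poly y"
  shows "little_oh_poly (\<lambda>t. x t - y t)"
  using little_oh_poly_add[OF assms(1) little_oh_poly_uminus[OF assms(2)]] by simp

quotient_type fermat = "real \<Rightarrow> real" / partial: fermat_rel
proof (rule part_equivpI)
  show "\<exists>x. fermat_rel x x"
    by (rule exI[of _ "\<lambda>_. 0"]) (simp add: fermat_rel_def little_oh_poly_const)
  show "symp fermat_rel"
  proof (rule sympI)
    fix x y assume "fermat_rel x y"
    then show "fermat_rel y x"
      unfolding fermat_rel_def
      using landau_o.small.uminus_in_iff[of "\<lambda>t. x t - y t" "at_right 0" "\<lambda>t. t"] by simp
  qed
  show "transp fermat_rel"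
  proof (rule transpI)
    fix x y z assume "fermat_rel x y" "fermat_rel y z"
    then show "fermat_rel x z"
      unfolding fermat_rel_def
      using sum_in_smallo(1)[of "\<lambda>t. x t - y t" "at_right 0" "\<lambda>t. t" "\<lambda>t. y t - z t"] by simp
  qed
qed

lemma fermat_rel_refl: "little_oh_poly x \<Longrightarrow> fermat_rel x x"
  by (simp add: fermat_rel_def)

lemma fermat_rel_eqI: "little_oh_poly x \<Longrightarrow> x = y \<Longrightarrow> fermat_rel x y"
  by (simp add: fermat_rel_def)

lemma fermat_rel_imp_little_oh_poly: "fermat_rel x y \<Longrightarrow> little_oh_poly x"
  by (simp add: fermat_rel_def)

lemmas little_oh_poly_intros =
  little_oh_poly_const little_oh_poly_add little_oh_poly_mult little_oh_poly_diff
  little_oh_poly_uminus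

instantiation fermat :: comm_ring_1
begin

lift_definition zero_fermat :: fermat is "\<lambda>_. 0"
  by (intro fermat_rel_refl little_oh_poly_const)

lift_definition one_fermat :: fermat is "\<lambda>_. 1"
  by (intro fermat_rel_refl little_oh_poly_const)

lift_definition plus_fermat :: "fermat \<Rightarrow> fermat \<Rightarrow> fermat" is "\<lambda>x y t. x t + y t"
proof -
  fix x x' y y' assume "fermat_rel x x'" "fermat_rel y y'"
  then show "fermat_rel (\<lambda>t. x t + y t) (\<lambda>t. x' t + y' t)"
    using sum_in_smallo(1)[of "\<lambda>t. x t - x' t" "at_right 0" "\<lambda>t. t" "\<lambda>t. y t - y' t"]
    by (auto simp: fermat_rel_def algebra_simps intro: little_oh_poly_add)
qed

lift_definition uminus_fermat :: "fermat \<Rightarrow> fermat" is "\<lambda>x t. - x t"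
proof -
  fix x x' assume "fermat_rel x x'"
  then show "fermat_rel (\<lambda>t. - x t) (\<lambda>t. - x' t)"
    using landau_o.small.uminus_in_iff[of "\<lambda>t. x t - x' t" "at_right 0" "\<lambda>t. t"]
    by (auto simp: fermat_rel_def algebra_simps intro: little_oh_poly_uminus)
qed

lift_definition minus_fermat :: "fermat \<Rightarrow> fermat \<Rightarrow> fermat" is "\<lambda>x y t. x t - y t"
proof -
  fix x x' y y' assume "fermat_rel x x'" "fermat_rel y y'"
  then show "fermat_rel (\<lambda>t. x t - y t) (\<lambda>t. x' t - y' t)"
    using sum_in_smallo(2)[of "\<lambda>t. x t - x' t" "at_right 0" "\<lambda>t. t" "\<lambda>t. y t - y' t"]
    by (auto simp: fermat_rel_def algebra_simps intro: little_oh_poly_diff)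
qed

lift_definition times_fermat :: "fermat \<Rightarrow> fermat \<Rightarrow> fermat" is "\<lambda>x y t. x t * y t"
proof -
  fix x x' y y' assume "fermat_rel x x'" "fermat_rel y y'"
  then show "fermat_rel (\<lambda>t. x t * y t) (\<lambda>t. x' t * y' t)"
    by (auto simp: fermat_rel_def
        intro!: little_oh_poly_mult smallo_mult_diff little_oh_poly_bounded)
qed

instance
proof
  show "(0::fermat) \<noteq> 1"
  proof
    assume "(0::fermat) = 1"
    then have "(\<lambda>t::real. 0 - 1 :: real) \<in> o[at_right 0](\<lambda>t. t)"
      by transfer (simp add: fermat_rel_def)
    then have "(\<lambda>t::real. 0 - 1 :: real) \<in> o[at_right 0](\<lambda>_. 1::real)"
      by (rule landau_o.small_trans[OF _ id_smallo_1_at_right_0])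
    then have "((\<lambda>_::real. (0 - 1) / 1 :: real) \<longlongrightarrow> 0) (at_right 0)"
      by (rule smalloD_tendsto)
    then have "(0 - 1) / 1 = (0::real)"
      by (simp only: tendsto_const_iff trivial_limit_at_right_real not_False_eq_True)
    then show False by simp
  qed
qed (transfer, rule fermat_rel_eqI,
     (intro little_oh_poly_intros; erule fermat_rel_imp_little_oh_poly),
     simp add: algebra_simps)+

end

lift_definition fermat_of_real :: "real \<Rightarrow> fermat" is "\<lambda>r _. r"
  by (intro fermat_rel_refl little_oh_poly_const)

text \<open>Only used for \<open>a > 0\<close>; the value for \<open>a \<le> 0\<close> is a dummy.\<close>

lift_definition dt :: "real \<Rightarrow> fermat" is "\<lambda>a t. if a > 0 then t powr (1 / a) else 0"
proof -
  fix a :: real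
  show "fermat_rel (\<lambda>t. if a > 0 then t powr (1 / a) else 0)
          (\<lambda>t. if a > 0 then t powr (1 / a) else 0)"
    by (cases "a > 0")
      (simp_all add: fermat_rel_refl little_oh_poly_powr little_oh_poly_const)
qed

definition fermat_decomposition ::
    "fermat \<Rightarrow> real \<Rightarrow> nat \<Rightarrow> (nat \<Rightarrow> real) \<Rightarrow> (nat \<Rightarrow> real) \<Rightarrow> bool" where
  "fermat_decomposition x r N \<alpha> a \<longleftrightarrow>
     (\<forall>i\<in>{1..N}. \<alpha> i \<noteq> 0) \<and>
     strict_antimono_on {1..N} a \<and> (\<forall>i\<in>{1..N}. a i \<ge> 1) \<and>
     x = fermat_of_real r + (\<Sum>i=1..N. fermat_of_real (\<alpha> i) * dt (a i))"

definition standard_part :: "fermat \<Rightarrow> real" where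
  "standard_part x = (THE r. \<exists>N \<alpha> a. fermat_decomposition x r N \<alpha> a)"

definition fermat_order :: "fermat \<Rightarrow> real" where
  "fermat_order x =
     (THE w. \<exists>r N \<alpha> a. fermat_decomposition x r N \<alpha> a \<and> w = (if N \<ge> 1 then a 1 else 0))"

definition d_omega :: "fermat \<Rightarrow> fermat \<Rightarrow> real" where
  "d_omega x y = \<bar>standard_part x - standard_part y\<bar> + fermat_order (x - y)"

end

theory Submission
  imports Defs
begin

text \<open>
  Every Fermat real is the class of a unique real-exponent polynomial with exponents in
  \<open>[0, 1]\<close>: by comparing with the lowest power, such a polynomial is \<open>o(t)\<close> only if it is zero.
  Orders of non-real elements are the inverses of exponents in \<open>(0, 1]\<close>, hence at least \<open>1\<close>.
  So a Cauchy sequence for \<open>d\<^sub>\<omega>\<close> eventually differs from one of its members only by real numbers,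
  and completeness is inherited from the reals.
\<close>

section \<open>Linear independence of the powers modulo o(t)\<close>

lemma smallo_powr_sum_imp_zero:
  fixes c :: "real \<Rightarrow> real"
  assumes fin: "finite S" and S: "S \<subseteq> {..1}"
    and o: "(\<lambda>t. \<Sum>e\<in>S. c e * t powr e) \<in> o[at_right 0](\<lambda>t. t)"
  shows "\<forall>e\<in>S. c e = 0"
proof (rule ccontr)
  define T where "T = {e \<in> S. c e \<noteq> 0}"
  assume "\<not> ?thesis"
  then have T: "finite T" "T \<noteq> {}" using fin by (auto simp: T_def)
  define m where "m = Min T"
  have m: "m \<in> T" "\<And>e. e \<in> T \<Longrightarrow> m \<le> e" using T by (auto simp: m_def)
  then have "m \<le> 1" "c m \<noteq> 0" using S by (auto simp: T_def)
  have eq: "(\<Sum>e\<in>S. c e * t powr e) = (\<Sum>e\<in>T. c e * t powr e)" for t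
    by (rule sum.mono_neutral_right) (use fin in \<open>auto simp: T_def\<close>)
  have pos: "eventually (\<lambda>t::real. t \<in> {0<..<1}) (at_right 0)"
    by (rule eventually_at_right_real) simp
  have "((\<lambda>t. (\<Sum>e\<in>S. c e * t powr e) / t) \<longlongrightarrow> 0) (at_right 0)"
    by (rule smalloD_tendsto[OF o])
  \<comment> \<open>As m \<le> 1, on (0, 1) the divisor \<open>t powr m\<close> is at least t, so
    this quotient is dominated by the one above.\<close>
  then have "((\<lambda>t. (\<Sum>e\<in>S. c e * t powr e) / t powr m) \<longlongrightarrow> 0) (at_right 0)"
  proof (rule Lim_null_comparison[rotated, OF tendsto_rabs_zero])
    show "eventually (\<lambda>t. norm ((\<Sum>e\<in>S. c e * t powr e) / t powr m)
        \<le> \<bar>(\<Sum>e\<in>S. c e * t powr e) / t\<bar>) (at_right 0)"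
      using pos
    proof eventually_elim
      case (elim t)
      then have "t powr 1 \<le> t powr m" using \<open>m \<le> 1\<close> by (intro powr_mono') auto
      then show ?case using elim by (auto simp: abs_divide intro!: divide_left_mono)
    qed
  qed
  moreover have "((\<lambda>t. (\<Sum>e\<in>S. c e * t powr e) / t powr m) \<longlongrightarrow> c m) (at_right 0)"
  proof -
    \<comment> \<open>The lowest term is written as the constant 1 because \<open>0 powr 0\<close>
      is 0 in HOL; all other exponents e - m are positive, so their powers tend to 0.\<close>
    have "((\<lambda>t. \<Sum>e\<in>T. c e * (if e = m then 1 else t powr (e - m)))
        \<longlongrightarrow> (\<Sum>e\<in>T. c e * (if e = m then 1 else 0))) (at_right (0::real))"
    proof (intro tendsto_sum tendsto_mult tendsto_const)
      fix e assume "e \<in> T"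
      show "((\<lambda>t. if e = m then 1 else t powr (e - m)) \<longlongrightarrow> (if e = m then 1 else 0))
          (at_right (0::real))"
      proof (cases "e = m")
        case False
        with m(2)[OF \<open>e \<in> T\<close>] have "0 < e - m" by simp
        have "((\<lambda>t::real. t powr (e - m)) \<longlongrightarrow> 0 powr (e - m)) (at_right 0)"
          by (rule tendsto_powr')
            (use \<open>0 < e - m\<close> pos in \<open>auto elim!: eventually_mono\<close>)
        then show ?thesis using False by simp
      qed simp
    qed
    moreover have "(\<Sum>e\<in>T. c e * (if e = m then 1 else 0)) = c m"
      using m(1) T(1) by (simp add: if_distrib cong: if_cong)
    moreover have "eventually (\<lambda>t. (\<Sum>e\<in>T. c e * (if e = m then 1 else t powr (e - m)))
        = (\<Sum>e\<in>S. c e * t powr e) / t powr m) (at_right 0)"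
      using pos
      by eventually_elim
        (auto simp: eq sum_divide_distrib powr_diff intro!: sum.cong)
    ultimately show ?thesis by (simp only:) (rule Lim_transform_eventually)
  qed
  ultimately have "c m = 0"
    by (intro tendsto_unique[OF trivial_limit_at_right_real])
  with \<open>c m \<noteq> 0\<close> show False by simp
qed

section \<open>Classes of functions and of monomials\<close>

text \<open>The quotient is partial: on the domain of \<open>fermat_rel\<close>, equality of classes
  is the relation itself, and there only its o(t) condition remains to be checked.\<close>

lemma abs_fermat_eq_iff:
  assumes "little_oh_poly x" "little_oh_poly y"
  shows "abs_fermat x = abs_fermat y \<longleftrightarrow> (\<lambda>t. x t - y t) \<in> o[at_right 0](\<lambda>t. t)"
  using Quotient_rel[OF Quotient_fermat, of x y] assms
  by (auto simp: fermat_rel_refl) (auto simp: fermat_rel_def)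

lemma abs_fermat_cases:
  obtains f where "little_oh_poly f" "x = abs_fermat f"
  by (metis Quotient_abs_rep[OF Quotient_fermat] Quotient_rep_reflp[OF Quotient_fermat]
      fermat_rel_imp_little_oh_poly)

lemma abs_fermat_add:
  "little_oh_poly f \<Longrightarrow> little_oh_poly g \<Longrightarrow>
    abs_fermat f + abs_fermat g = abs_fermat (\<lambda>t. f t + g t)"
  by (simp add: plus_fermat.abs_eq fermat_rel_refl)

lemma abs_fermat_sum:
  assumes "finite A" "\<And>i. i \<in> A \<Longrightarrow> little_oh_poly (f i)"
  shows "(\<Sum>i\<in>A. abs_fermat (f i)) = abs_fermat (\<lambda>t. \<Sum>i\<in>A. f i t)"
  using assms
  by (induction A rule: finite_induct)
    (auto simp: zero_fermat.abs_eq abs_fermat_add little_oh_poly_sum)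

text \<open>A common form for real numbers (e = 0) and multiples of \<open>dt\<close> (e is the
  inverse of the order). For e \<ge> 0 the representative is a little-oh polynomial.\<close>

definition monomial :: "real \<Rightarrow> real \<Rightarrow> fermat" where
  "monomial a e = abs_fermat (\<lambda>t. a * t powr e)"

lemma fermat_of_real_eq_monomial: "fermat_of_real r = monomial r 0"
proof -
  \<comment> \<open>Since \<open>0 powr 0\<close> is 0, the two representatives can differ at t = 0;
    the germ at the right of 0 does not see this.\<close>
  have "eventually (\<lambda>t::real. r - r * t powr 0 = 0) (at_right 0)"
    using eventually_at_right_less[of 0] by eventually_elim simp
  then have "(\<lambda>t. r - r * t powr 0) \<in> o[at_right 0](\<lambda>t. t)"
    by (subst landau_o.small.in_cong[where g = "\<lambda>_. 0"]) auto
  then show ?thesis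
    unfolding monomial_def fermat_of_real.abs_eq
    by (subst abs_fermat_eq_iff) (intro little_oh_poly_const little_oh_poly_monom order_refl)+
qed

lemma fermat_of_real_mult_dt:
  assumes "a > 0"
  shows "fermat_of_real r * dt a = monomial r (1 / a)"
  using assms unfolding monomial_def fermat_of_real.abs_eq dt.abs_eq
  by (simp add: times_fermat.abs_eq fermat_rel_refl little_oh_poly_powr little_oh_poly_const)

text \<open>Division by t leaves the positive exponent e - 1, so the representative is o(t). This
  discards the exponents above 1.\<close>

lemma monomial_eq_0:
  assumes "e > 1"
  shows "monomial a e = 0"
proof -
  have "((\<lambda>t::real. t powr (e - 1)) \<longlongrightarrow> 0 powr (e - 1)) (at_right 0)"
    using assms eventually_at_right_less[of "0::real"]
    by (intro tendsto_powr') (auto elim!: eventually_mono)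
  then have "((\<lambda>t. a * t powr (e - 1)) \<longlongrightarrow> 0) (at_right 0)"
    by (auto intro: tendsto_mult_right_zero)
  moreover have "eventually (\<lambda>t. a * t powr (e - 1) = a * t powr e / t) (at_right 0)"
    using eventually_at_right_less[of 0] by eventually_elim (simp add: powr_diff)
  ultimately have "((\<lambda>t. a * t powr e / t) \<longlongrightarrow> 0) (at_right 0)"
    by (rule Lim_transform_eventually)
  then have "(\<lambda>t. a * t powr e) \<in> o[at_right 0](\<lambda>t. t)"
    by (rule smalloI_tendsto)
      (use eventually_at_right_less[of "0::real"] in \<open>auto elim: eventually_mono\<close>)
  then show ?thesis
    unfolding monomial_def zero_fermat.abs_eq using assms
    by (subst abs_fermat_eq_iff) (auto intro: little_oh_poly_const little_oh_poly_monom)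
qed

lemma monomial_0 [simp]: "monomial 0 e = 0"
  by (simp add: monomial_def zero_fermat.abs_eq)

lemma monomial_add: "e \<ge> 0 \<Longrightarrow> monomial (a + b) e = monomial a e + monomial b e"
  unfolding monomial_def by (subst abs_fermat_add) (auto simp: little_oh_poly_monom distrib_right)

lemma monomial_uminus: "e \<ge> 0 \<Longrightarrow> monomial (- a) e = - monomial a e"
  using monomial_add[of e a "- a"] by (simp add: minus_unique)

section \<open>Coefficient functions: arithmetic, uniqueness and existence\<close>

text \<open>Exponents rather than orders index the coefficients, so that the standard part is the
  coefficient at \<open>0\<close>.\<close>

definition has_coeffs :: "fermat \<Rightarrow> (real \<Rightarrow> real) \<Rightarrow> bool" where
  "has_coeffs x c \<longleftrightarrow> finite {e. c e \<noteq> 0} \<and> {e. c e \<noteq> 0} \<subseteq> {0..1} \<and>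
     x = (\<Sum>e | c e \<noteq> 0. monomial (c e) e)"

text \<open>Terms outside the support vanish by \<open>monomial_0\<close>; this lets two elements be
  expanded over one common index set.\<close>

lemma has_coeffsD_sum:
  assumes "has_coeffs x c" "finite S" "{e. c e \<noteq> 0} \<subseteq> S"
  shows "x = (\<Sum>e\<in>S. monomial (c e) e)"
proof -
  have "(\<Sum>e | c e \<noteq> 0. monomial (c e) e) = (\<Sum>e\<in>S. monomial (c e) e)"
    by (rule sum.mono_neutral_left) (use assms in auto)
  with assms show ?thesis by (simp add: has_coeffs_def)
qed

lemma has_coeffsI:
  assumes "finite S" "S \<subseteq> {0..1}" "{e. c e \<noteq> 0} \<subseteq> S" "x = (\<Sum>e\<in>S. monomial (c e) e)"
  shows "has_coeffs x c"
proof -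
  have "(\<Sum>e | c e \<noteq> 0. monomial (c e) e) = (\<Sum>e\<in>S. monomial (c e) e)"
    by (rule sum.mono_neutral_left) (use assms in auto)
  with assms show ?thesis by (auto simp: has_coeffs_def intro: finite_subset)
qed

lemma has_coeffs_0: "has_coeffs 0 (\<lambda>_. 0)"
  by (simp add: has_coeffs_def)

lemma has_coeffs_monomial:
  assumes "e \<in> {0..1}"
  shows "has_coeffs (monomial a e) (\<lambda>e'. if e' = e then a else 0)"
  by (rule has_coeffsI[of "{e}"]) (use assms in auto)

lemma has_coeffs_add:
  assumes "has_coeffs x c" "has_coeffs y d"
  shows "has_coeffs (x + y) (\<lambda>e. c e + d e)"
proof -
  \<comment> \<open>Coefficients may cancel, so S can be larger than the support of the sum;
    \<open>has_coeffsI\<close> allows for that.\<close>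
  define S where "S = {e. c e \<noteq> 0} \<union> {e. d e \<noteq> 0}"
  have S: "finite S" "S \<subseteq> {0..1}" using assms by (auto simp: S_def has_coeffs_def)
  have "x + y = (\<Sum>e\<in>S. monomial (c e) e) + (\<Sum>e\<in>S. monomial (d e) e)"
    using has_coeffsD_sum[OF assms(1) S(1)] has_coeffsD_sum[OF assms(2) S(1)] by (auto simp: S_def)
  also have "\<dots> = (\<Sum>e\<in>S. monomial (c e + d e) e)"
    unfolding sum.distrib[symmetric] using S(2) by (intro sum.cong) (auto simp: monomial_add)
  finally show ?thesis using S by (intro has_coeffsI[of S]) (auto simp: S_def)
qed

lemma has_coeffs_uminus:
  assumes "has_coeffs x c"
  shows "has_coeffs (- x) (\<lambda>e. - c e)"
  using assms unfolding has_coeffs_def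
  by (auto simp: sum_negf[symmetric] monomial_uminus intro!: sum.cong)

lemma has_coeffs_diff:
  assumes "has_coeffs x c" "has_coeffs y d"
  shows "has_coeffs (x - y) (\<lambda>e. c e - d e)"
  using has_coeffs_add[OF assms(1) has_coeffs_uminus[OF assms(2)]] by simp

lemma has_coeffs_sum:
  assumes "finite A" "\<And>i. i \<in> A \<Longrightarrow> has_coeffs (x i) (c i)"
  shows "has_coeffs (\<Sum>i\<in>A. x i) (\<lambda>e. \<Sum>i\<in>A. c i e)"
  using assms by (induction A rule: finite_induct) (auto simp: has_coeffs_0 has_coeffs_add)

text \<open>A class is 0 when its representative is o(t), so linear independence of the powers
  passes to the quotient.\<close>

lemma has_coeffs_0_unique:
  assumes "has_coeffs 0 c"
  shows "c e = 0"
proof -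
  define S where "S = {e. c e \<noteq> 0}"
  have S: "finite S" "S \<subseteq> {0..1}" using assms by (auto simp: S_def has_coeffs_def)
  have lop: "little_oh_poly (\<lambda>t. c e * t powr e)" if "e \<in> S" for e
    using that S(2) by (intro little_oh_poly_monom) auto
  have "abs_fermat (\<lambda>t. \<Sum>e\<in>S. c e * t powr e) = abs_fermat (\<lambda>_. 0)"
    using assms abs_fermat_sum[of S "\<lambda>e t. c e * t powr e", OF S(1) lop]
    by (simp add: has_coeffs_def monomial_def S_def zero_fermat.abs_eq)
  then have "(\<lambda>t. \<Sum>e\<in>S. c e * t powr e) \<in> o[at_right 0](\<lambda>t. t)"
    by (subst (asm) abs_fermat_eq_iff) (auto intro!: little_oh_poly_sum lop S little_oh_poly_const)
  moreover have "S \<subseteq> {..1}" using S(2) by auto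
  ultimately have "\<forall>e\<in>S. c e = 0" by (intro smallo_powr_sum_imp_zero[OF S(1)])
  then show ?thesis by (auto simp: S_def)
qed

lemma has_coeffs_unique:
  assumes "has_coeffs x c" "has_coeffs x d"
  shows "c = d"
  using has_coeffs_0_unique[of "\<lambda>e. c e - d e"] has_coeffs_diff[OF assms] by fastforce

text \<open>Any representative is, up to o(t), a finite sum of monomials. Repeated exponents merge
  because coefficient functions are added pointwise.\<close>

lemma has_coeffs_exists: "\<exists>c. has_coeffs x c"
proof -
  obtain f where f: "little_oh_poly f" "x = abs_fermat f" by (rule abs_fermat_cases)
  then obtain r N a \<alpha> where *: "\<forall>i\<in>{1..N::nat}. \<alpha> i \<ge> (0::real)"
    "(\<lambda>t. f t - (r + (\<Sum>i=1..N. a i * t powr \<alpha> i))) \<in> o[at_right 0](\<lambda>t. t)"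
    unfolding little_oh_poly_def by blast
  have lop: "little_oh_poly (\<lambda>t. a i * t powr \<alpha> i)" if "i \<in> {1..N}" for i
    using that *(1) by (intro little_oh_poly_monom) auto
  have "x = abs_fermat (\<lambda>t. r + (\<Sum>i=1..N. a i * t powr \<alpha> i))"
    using f * lop by (subst f, subst abs_fermat_eq_iff)
      (auto intro!: little_oh_poly_add little_oh_poly_sum little_oh_poly_const)
  also have "\<dots> = fermat_of_real r + (\<Sum>i=1..N. monomial (a i) (\<alpha> i))"
    unfolding monomial_def fermat_of_real.abs_eq
    by (subst abs_fermat_sum, simp, erule lop, subst abs_fermat_add)
      (auto intro!: lop little_oh_poly_sum little_oh_poly_const)
  finally have x: "x = monomial r 0 + (\<Sum>i=1..N. monomial (a i) (\<alpha> i))"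
    by (simp add: fermat_of_real_eq_monomial)
  \<comment> \<open>An exponent above 1 gives the zero class, whose coefficient function is
    0.\<close>
  have "\<exists>c. has_coeffs (monomial (a i) (\<alpha> i)) c" if "i \<in> {1..N}" for i
    using that *(1) has_coeffs_monomial[of "\<alpha> i" "a i"] has_coeffs_0 monomial_eq_0[of "\<alpha> i" "a i"]
    by (cases "\<alpha> i \<le> 1") auto
  then obtain c where "\<And>i. i \<in> {1..N} \<Longrightarrow> has_coeffs (monomial (a i) (\<alpha> i)) (c i)" by metis
  then have "has_coeffs (\<Sum>i=1..N. monomial (a i) (\<alpha> i)) (\<lambda>e. \<Sum>i=1..N. c i e)"
    by (intro has_coeffs_sum) auto
  from has_coeffs_add[OF has_coeffs_monomial[of 0 r] this] show ?thesis using x by auto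
qed

section \<open>Coefficient functions versus decompositions\<close>

text \<open>In \<open>inverse ` {e. c e \<noteq> 0}\<close> the exponent \<open>0\<close> of the standard part contributes
  \<open>inverse 0 = 0\<close>, which is harmless since the order of a real number is \<open>0\<close>.\<close>

lemma fermat_decomposition_imp_has_coeffs:
  assumes "fermat_decomposition x r N \<alpha> a"
  obtains c where "has_coeffs x c" "c 0 = r"
    "(if N \<ge> 1 then a 1 else 0) = Max (insert 0 (inverse ` {e. c e \<noteq> 0}))"
proof -
  have \<alpha>0: "\<alpha> i \<noteq> 0" and a1: "a i \<ge> 1" if "i \<in> {1..N}" for i
    using assms that by (auto simp: fermat_decomposition_def)
  have mono: "a j < a i" if "i \<in> {1..N}" "j \<in> {1..N}" "i < j" for i j
    using assms that by (auto simp: fermat_decomposition_def monotone_on_def)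
  have inj: "inj_on a {1..N}"
    by (rule inj_onI) (metis mono less_irrefl linorder_neqE_nat)
  \<comment> \<open>The sum of the coefficient functions of the single terms, in the shape that
    \<open>has_coeffs_add\<close> and \<open>has_coeffs_sum\<close> produce. Injectivity of
    \<open>a\<close> later isolates one summand at each \<open>1 / a i\<close>.\<close>
  define c where "c e = (if e = 0 then r else 0) +
    (\<Sum>i=1..N. if e = 1 / a i then \<alpha> i else 0)" for e
  have "x = monomial r 0 + (\<Sum>i=1..N. monomial (\<alpha> i) (1 / a i))"
  proof -
    have "fermat_of_real (\<alpha> i) * dt (a i) = monomial (\<alpha> i) (1 / a i)" if "i \<in> {1..N}" for i
      using a1[OF that] by (intro fermat_of_real_mult_dt) simp
    then have "(\<Sum>i=1..N. fermat_of_real (\<alpha> i) * dt (a i)) = (\<Sum>i=1..N. monomial (\<alpha> i) (1 / a i))"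
      by (intro sum.cong refl)
    then show ?thesis
      using assms by (simp add: fermat_decomposition_def fermat_of_real_eq_monomial)
  qed
  moreover have "has_coeffs \<dots> c"
    unfolding c_def
  proof (intro has_coeffs_add has_coeffs_sum has_coeffs_monomial)
    show "1 / a i \<in> {0..1}" if "i \<in> {1..N}" for i using a1[OF that] by simp
  qed auto
  ultimately have c: "has_coeffs x c" by simp
  have "(\<Sum>i=1..N. if 0 = 1 / a i then \<alpha> i else 0) = 0"
    using a1 by (intro sum.neutral) force
  then have c0: "c 0 = r" by (simp add: c_def)
  have ci: "c (1 / a i) = \<alpha> i" if i: "i \<in> {1..N}" for i
  proof -
    have "a i \<noteq> 0" using a1[OF i] by auto
    moreover have "(\<Sum>j=1..N. if 1 / a i = 1 / a j then \<alpha> j else 0)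
        = (\<Sum>j=1..N. if i = j then \<alpha> j else 0)"
    proof (intro sum.cong refl)
      fix j assume "j \<in> {1..N}"
      then have "1 / a i = 1 / a j \<longleftrightarrow> i = j" using inj_on_eq_iff[OF inj i] by simp
      then show "(if 1 / a i = 1 / a j then \<alpha> j else 0) = (if i = j then \<alpha> j else 0)" by simp
    qed
    ultimately show ?thesis using i by (simp add: c_def)
  qed
  have "e = 0 \<or> (\<exists>i\<in>{1..N}. e = 1 / a i)" if "c e \<noteq> 0" for e
    using that by (rule contrapos_np) (auto simp: c_def intro!: sum.neutral)
  then have "insert 0 (inverse ` {e. c e \<noteq> 0}) \<subseteq> insert 0 (a ` {1..N})"
    by (force simp: inverse_eq_divide)
  moreover have "a i \<in> inverse ` {e. c e \<noteq> 0}" if "i \<in> {1..N}" for i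
    using ci[OF that] \<alpha>0[OF that]
    by (intro image_eqI[of _ _ "1 / a i"]) (simp_all add: inverse_eq_divide)
  ultimately have eq: "insert 0 (inverse ` {e. c e \<noteq> 0}) = insert 0 (a ` {1..N})" by blast
  \<comment> \<open>The orders decrease from the first one on and are positive; for N = 0 only the
    inserted 0 is left.\<close>
  have "Max (insert 0 (a ` {1..N})) = (if N \<ge> 1 then a 1 else 0)"
  proof (cases "N \<ge> 1")
    case True
    have "a i \<le> a 1" if "i \<in> {1..N}" for i
      using mono[of 1 i] that True by (cases "i = 1") auto
    moreover have "0 \<le> a 1" using a1[of 1] True by simp
    ultimately have "Max (insert 0 (a ` {1..N})) = a 1"
      using True by (intro Max_eqI) auto
    then show ?thesis using True by simp
  qed auto
  with that[OF c c0] eq show ?thesis by simp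
qed

text \<open>Listing the positive exponents increasingly makes their inverses, the orders, strictly
  decreasing; the exponent 0 is split off as the standard part.\<close>

lemma has_coeffs_imp_fermat_decomposition:
  assumes "has_coeffs x c"
  shows "\<exists>N \<alpha> a. fermat_decomposition x (c 0) N \<alpha> a"
proof -
  define S where "S = {e. c e \<noteq> 0} - {0}"
  have S: "finite S" "S \<subseteq> {0<..1}" using assms by (auto simp: S_def has_coeffs_def less_le)
  \<comment> \<open>List positions start at 0, indices of a decomposition at 1.\<close>
  define h where "h = (\<lambda>i. sorted_list_of_set S ! (i - 1))"
  have bij: "bij_betw h {1..card S} S"
  proof (rule bij_betw_trans[of "\<lambda>i. i - 1" _ "{..<card S}", unfolded comp_def,
        of _ "\<lambda>i. sorted_list_of_set S ! i" S, folded h_def])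
    show "bij_betw (\<lambda>i. i - 1) {1..card S} {..<card S}"
      by (rule bij_betw_byWitness[of _ Suc]) auto
    show "bij_betw ((!) (sorted_list_of_set S)) {..<card S} S"
      using S(1) by (intro bij_betw_nth) auto
  qed
  have mono: "h i < h j" if "i \<in> {1..card S}" "j \<in> {1..card S}" "i < j" for i j
    unfolding h_def by (rule sorted_wrt_nth_less[OF strict_sorted_list_of_set]) (use that in auto)
  have hS: "h i \<in> S" if "i \<in> {1..card S}" for i using bij that by (auto simp: bij_betw_def)
  have h01: "0 < h i" "h i \<le> 1" if "i \<in> {1..card S}" for i using hS[OF that] S(2) by auto
  have "x = (\<Sum>e\<in>insert 0 S. monomial (c e) e)"
    using S(1) by (intro has_coeffsD_sum[OF assms]) (auto simp: S_def)
  also have "\<dots> = fermat_of_real (c 0) + (\<Sum>e\<in>S. monomial (c e) e)"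
    using S by (subst sum.insert) (auto simp: fermat_of_real_eq_monomial)
  also have "(\<Sum>e\<in>S. monomial (c e) e) = (\<Sum>i=1..card S. monomial (c (h i)) (h i))"
    by (rule sum.reindex_bij_betw[OF bij, symmetric])
  also have "\<dots> = (\<Sum>i=1..card S. fermat_of_real (c (h i)) * dt (1 / h i))"
    using h01 by (intro sum.cong) (auto simp: fermat_of_real_mult_dt)
  finally have "fermat_decomposition x (c 0) (card S) (\<lambda>i. c (h i)) (\<lambda>i. 1 / h i)"
    unfolding fermat_decomposition_def
    using hS h01 by (auto simp: S_def monotone_on_def intro!: divide_strict_left_mono mono)
  then show ?thesis by blast
qed

text \<open>The definite description is legitimate because every decomposition of x gives back the
  unique coefficient function, whose value at 0 is its real term.\<close>

lemma standard_part_eq: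
  assumes "has_coeffs x c"
  shows "standard_part x = c 0"
  unfolding standard_part_def
proof (rule the_equality)
  show "\<exists>N \<alpha> a. fermat_decomposition x (c 0) N \<alpha> a"
    by (rule has_coeffs_imp_fermat_decomposition[OF assms])
  fix r assume "\<exists>N \<alpha> a. fermat_decomposition x r N \<alpha> a"
  then obtain N \<alpha> a where "fermat_decomposition x r N \<alpha> a" by blast
  then obtain d where "has_coeffs x d" "d 0 = r"
    by (rule fermat_decomposition_imp_has_coeffs)
  then show "r = c 0" using has_coeffs_unique[OF assms] by blast
qed

text \<open>By uniqueness of the coefficients, all decompositions of x have the same leading order,
  the inverse of the least positive exponent if there is one.\<close>

lemma fermat_order_eq:
  assumes "has_coeffs x c"
  shows "fermat_order x = Max (insert 0 (inverse ` {e. c e \<noteq> 0}))"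
proof -
  let ?M = "Max (insert 0 (inverse ` {e. c e \<noteq> 0}))"
  have *: "(if N \<ge> 1 then a 1 else 0) = ?M" if D: "fermat_decomposition x r N \<alpha> a" for r N \<alpha> a
  proof -
    obtain d where "has_coeffs x d"
      "(if N \<ge> 1 then a 1 else 0) = Max (insert 0 (inverse ` {e. d e \<noteq> 0}))"
      by (rule fermat_decomposition_imp_has_coeffs[OF D])
    then show ?thesis using has_coeffs_unique[OF assms] by simp
  qed
  obtain N \<alpha> a where D: "fermat_decomposition x (c 0) N \<alpha> a"
    using has_coeffs_imp_fermat_decomposition[OF assms] by blast
  show ?thesis
    unfolding fermat_order_def
  proof (rule the_equality)
    show "\<exists>r N \<alpha> a. fermat_decomposition x r N \<alpha> a \<and> ?M = (if N \<ge> 1 then a 1 else 0)"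
      using D *[OF D, symmetric] by blast
  next
    fix w assume "\<exists>r N \<alpha> a. fermat_decomposition x r N \<alpha> a \<and> w = (if N \<ge> 1 then a 1 else 0)"
    then obtain r N \<alpha> a where "fermat_decomposition x r N \<alpha> a" "w = (if N \<ge> 1 then a 1 else 0)"
      by blast
    with * show "w = ?M" by simp
  qed
qed

section \<open>Algebraic properties of the standard part and the order\<close>

lemma fermat_of_real_diff: "fermat_of_real (r - s) = fermat_of_real r - fermat_of_real s"
  using monomial_add[of 0 "r - s" s] by (simp add: fermat_of_real_eq_monomial)

lemma has_coeffs_fermat_of_real: "has_coeffs (fermat_of_real r) (\<lambda>e. if e = 0 then r else 0)"
  using has_coeffs_monomial[of 0 r] by (simp add: fermat_of_real_eq_monomial)

lemma standard_part_fermat_of_real [simp]: "standard_part (fermat_of_real r) = r"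
  by (simp add: standard_part_eq[OF has_coeffs_fermat_of_real])

lemma fermat_order_fermat_of_real [simp]: "fermat_order (fermat_of_real r) = 0"
proof -
  have "{e::real. (if e = 0 then r else 0) \<noteq> 0} = (if r = 0 then {} else {0})" by auto
  then have "insert 0 (inverse ` {e::real. (if e = 0 then r else 0) \<noteq> 0}) = {0}" by simp
  then show ?thesis
    unfolding fermat_order_eq[OF has_coeffs_fermat_of_real] by (simp only: Max_singleton)
qed

lemma standard_part_add: "standard_part (x + y) = standard_part x + standard_part y"
proof -
  obtain c d where "has_coeffs x c" "has_coeffs y d" using has_coeffs_exists by blast
  then show ?thesis using has_coeffs_add[of x c y d] by (simp add: standard_part_eq)
qed

lemma standard_part_diff: "standard_part (x - y) = standard_part x - standard_part y"
  using standard_part_add[of "x - y" y] by simp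

lemma fermat_order_nonneg: "0 \<le> fermat_order x"
proof -
  obtain c where c: "has_coeffs x c" using has_coeffs_exists by blast
  then show ?thesis unfolding fermat_order_eq[OF c] by (intro Max_ge) (simp_all add: has_coeffs_def)
qed

lemma fermat_order_uminus: "fermat_order (- x) = fermat_order x"
proof -
  obtain c where c: "has_coeffs x c" using has_coeffs_exists by blast
  show ?thesis by (simp add: fermat_order_eq[OF c] fermat_order_eq[OF has_coeffs_uminus[OF c]])
qed

text \<open>A non-zero coefficient of the sum requires one in x or in y at the same exponent; hence
  an ultrametric inequality.\<close>

lemma fermat_order_add_le: "fermat_order (x + y) \<le> max (fermat_order x) (fermat_order y)"
proof -
  obtain c d where cd: "has_coeffs x c" "has_coeffs y d" using has_coeffs_exists by metis
  then have fin: "finite {e. c e \<noteq> 0}" "finite {e. d e \<noteq> 0}" by (auto simp: has_coeffs_def)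
  have "fermat_order (x + y) = Max (insert 0 (inverse ` {e. c e + d e \<noteq> 0}))"
    by (rule fermat_order_eq[OF has_coeffs_add[OF cd]])
  also have "\<dots> \<le> Max (insert 0 (inverse ` {e. c e \<noteq> 0}) \<union> insert 0 (inverse ` {e. d e \<noteq> 0}))"
    using fin by (intro Max_mono) auto
  also have "\<dots> = max (fermat_order x) (fermat_order y)"
    using fin
    by (subst Max_Un) (simp_all add: fermat_order_eq[OF cd(1)] fermat_order_eq[OF cd(2)])
  finally show ?thesis .
qed

text \<open>A non-zero exponent lies in (0, 1] and has an inverse of at least 1, so the order has a
  gap between 0 and 1. Both separation of points and completeness rest on this gap.\<close>

lemma fermat_order_less_1_imp_real:
  assumes "fermat_order x < 1"
  shows "x = fermat_of_real (standard_part x)"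
proof -
  obtain c where c: "has_coeffs x c" using has_coeffs_exists by blast
  have "e = 0" if "c e \<noteq> 0" for e
  proof (rule ccontr)
    assume "e \<noteq> 0"
    with c that have "0 < e" "e \<le> 1" by (auto simp: has_coeffs_def less_le)
    then have "1 \<le> inverse e" by (simp add: one_le_inverse)
    also have "inverse e \<le> fermat_order x"
      unfolding fermat_order_eq[OF c]
      using c that by (intro Max_ge) (auto simp: has_coeffs_def)
    finally show False using assms by simp
  qed
  then have "{e. c e \<noteq> 0} \<subseteq> {0}" by auto
  from has_coeffsD_sum[OF c _ this] have "x = fermat_of_real (c 0)"
    by (simp add: fermat_of_real_eq_monomial)
  then show ?thesis unfolding standard_part_eq[OF c] .
qed

section \<open>The metric and its completeness\<close>

lemma Metric_space_d_omega: "Metric_space UNIV d_omega"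
proof
  fix x y z :: fermat
  show "0 \<le> d_omega x y" by (simp add: d_omega_def fermat_order_nonneg)
  show "d_omega x y = d_omega y x"
    using fermat_order_uminus[of "x - y"] by (simp add: d_omega_def abs_minus_commute)
  show "d_omega x y = 0 \<longleftrightarrow> x = y"
  proof
    assume "d_omega x y = 0"
    then have "standard_part x = standard_part y" "fermat_order (x - y) = 0"
      using fermat_order_nonneg[of "x - y"] by (auto simp: d_omega_def)
    \<comment> \<open>Order 0 makes x - y real, and its standard part is 0.\<close>
    then have "x - y = fermat_of_real 0"
      using fermat_order_less_1_imp_real[of "x - y"] by (simp add: standard_part_diff)
    then show "x = y" by (simp add: fermat_of_real_eq_monomial)
  qed (use fermat_order_fermat_of_real[of 0] in \<open>simp add: d_omega_def fermat_of_real_eq_monomial\<close>)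
  \<comment> \<open>For the order term, the maximum of two nonnegative orders is at most their
    sum.\<close>
  show "d_omega x z \<le> d_omega x y + d_omega y z"
    using fermat_order_add_le[of "x - y" "y - z"] fermat_order_nonneg[of "x - y"]
      fermat_order_nonneg[of "y - z"] by (simp add: d_omega_def)
qed

interpretation d_omega: Metric_space UNIV d_omega
  by (rule Metric_space_d_omega)

lemma mcomplete_d_omega: "d_omega.mcomplete"
  unfolding d_omega.mcomplete_def
proof (intro allI impI)
  fix \<sigma> assume Cauchy: "d_omega.MCauchy \<sigma>"
  \<comment> \<open>Radius 1 is the width of the gap in the order: from N on, all differences from
    \<open>\<sigma> N\<close> are real.\<close>
  then obtain N where N: "\<And>n. n \<ge> N \<Longrightarrow> d_omega (\<sigma> n) (\<sigma> N) < 1"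
    unfolding d_omega.MCauchy_def by (meson order_refl zero_less_one)
  define s where "s n = standard_part (\<sigma> n)" for n
  have \<sigma>: "\<sigma> n = \<sigma> N + fermat_of_real (s n - s N)" if "n \<ge> N" for n
  proof -
    have "fermat_order (\<sigma> n - \<sigma> N) < 1" using N[OF that] by (simp add: d_omega_def)
    from fermat_order_less_1_imp_real[OF this] show ?thesis
      by (simp add: s_def standard_part_diff algebra_simps)
  qed
  \<comment> \<open>Dropping the nonnegative order term shows that the standard parts form a Cauchy
    sequence of reals.\<close>
  have "dist (s m) (s n) \<le> d_omega (\<sigma> m) (\<sigma> n)" for m n
    by (simp add: s_def d_omega_def dist_real_def fermat_order_nonneg)
  then have "Cauchy s"
    using Cauchy unfolding Cauchy_def d_omega.MCauchy_def by (meson le_less_trans)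
  then obtain L where L: "s \<longlonglongrightarrow> L" using Cauchy_convergent convergent_def by blast
  \<comment> \<open>The limit keeps the infinitesimal part of \<open>\<sigma> N\<close>, common to
    all later terms, and takes L as its standard part.\<close>
  define l where "l = \<sigma> N + fermat_of_real (L - s N)"
  have d: "d_omega (\<sigma> n) l = \<bar>s n - L\<bar>" if "n \<ge> N" for n
  proof -
    have "standard_part l = L" by (simp add: l_def standard_part_add s_def)
    moreover have "\<sigma> n - l = fermat_of_real (s n - L)"
      using \<sigma>[OF that] by (simp add: l_def fermat_of_real_diff)
    ultimately show ?thesis by (simp add: d_omega_def s_def)
  qed
  have "(\<lambda>n. d_omega (\<sigma> n) l) \<longlonglongrightarrow> 0"
  proof (rule Lim_transform_eventually)
    show "(\<lambda>n. \<bar>s n - L\<bar>) \<longlonglongrightarrow> 0" using L by (simp add: LIM_zero tendsto_rabs_zero)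
    show "eventually (\<lambda>n. \<bar>s n - L\<bar> = d_omega (\<sigma> n) l) sequentially"
      using eventually_ge_at_top[of N] by eventually_elim (simp add: d)
  qed
  then show "\<exists>x. limitin d_omega.mtopology \<sigma> x sequentially"
    by (auto simp: d_omega.limitin_metric_dist_null)
qed

theorem theorem11:
  shows "Metric_space (UNIV :: fermat set) d_omega \<and>
         Metric_space.mcomplete (UNIV :: fermat set) d_omega"
  using Metric_space_d_omega mcomplete_d_omega by blast

end
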